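(* For every integer $n \geq 0$, $$C_n = \frac{(-1)^n}{n!}\sum_{m=0}^n 2^{2n-m} E_m S_1(n,m).$$
   Context: $C_n = \frac{1}{n+1}\binom{2n}{n}$ is the $n$-th Catalan number. The Euler numbers $E_n$ are defined by $\frac{2}{e^t+1} = \sum_{n\ge 0} E_n \frac{t^n}{n!}$. The Stirling numbers of the first kind $S_1(n,l)$ are defined by $x(x-1)\cdots(x-n+1) = \sum_{l=0}^n S_1(n,l)x^l$. *)

theory Defs
  imports
    Complex_Main
    "HOL-Computational_Algebra.Polynomial"
    "HOL-Computational_Algebra.Formal_Power_Series"
begin

definition catalan :: "nat \<Rightarrow> real" where
  "catalan n = 1 / real (n + 1) * real ((2 * n) choose n)"

text \<open>
  The number \<open>E\<^sub>n\<close> is \<open>n!\<close> times the coefficient of \<open>t\<^sup>n\<close> in \<open>2 / (e\<^sup>t + 1)\<close>, read as a formal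
  power series (the denominator has constant term 2, so it is a unit). These are not the Euler
  numbers given by \<open>1 / cosh t\<close>: here \<open>E\<^sub>1 = -1/2\<close> and \<open>E\<^sub>2 = 0\<close>.
\<close>
definition euler_number :: "nat \<Rightarrow> real" where
  "euler_number n = fact n * fps_nth (2 / (fps_exp 1 + 1)) n"

text \<open>
  Signed Stirling numbers of the first kind: the coefficients of
  \<open>x (x - 1) \<dots> (x - n + 1)\<close>. The function \<open>stirling\<close> of \<open>HOL-Combinatorics\<close> is the unsigned variant.
\<close>
definition S1 :: "nat \<Rightarrow> nat \<Rightarrow> int" where
  "S1 n l = coeff (\<Prod>i<n. [:- int i, 1:]) l"

end

theory Submission
  imports Defs
begin

text \<open>
  Let \<open>L\<close> be the linear functional on polynomials with \<open>L(x\<^sup>m) = E\<^sub>m\<close>. The equation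
  \<open>(e\<^sup>t + 1) \<Sum> E\<^sub>m t\<^sup>m / m! = 2\<close> says that \<open>L(p(x + 1)) + L(p(x)) = 2 p(0)\<close>. The right-hand side of
  the theorem is \<open>(-4)\<^sup>n L(x/2 choose n)\<close>. By Vandermonde, the generating function \<open>A(s)\<close> of
  \<open>L(x/2 choose n)\<close> satisfies \<open>A(s) (1 + (1 + s)\<^bsup>1/2\<^esup>) = 2\<close>; multiplying by \<open>(1 + s)\<^bsup>1/2\<^esup> - 1\<close> gives
  \<open>s A(s) = 2 ((1 + s)\<^bsup>1/2\<^esup> - 1)\<close>, so that \<open>L(x/2 choose n) = 2 (1/2 choose n + 1)\<close>.
\<close>

definition euler_functional :: "real poly \<Rightarrow> real" where
  "euler_functional p = (\<Sum>m\<le>degree p. coeff p m * euler_number m)"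

text \<open>Coefficients beyond the degree vanish, so polynomials of different degrees can share one
  range of summation.\<close>

lemma euler_functional_altdef:
  assumes "degree p \<le> N"
  shows "euler_functional p = (\<Sum>m\<le>N. coeff p m * euler_number m)"
  unfolding euler_functional_def using assms
  by (intro sum.mono_neutral_left) (auto simp: coeff_eq_0)

lemma euler_functional_add:
  "euler_functional (p + q) = euler_functional p + euler_functional q"
proof -
  define N where "N = max (degree p) (degree q)"
  have "degree p \<le> N" "degree q \<le> N" "degree (p + q) \<le> N"
    by (auto simp: N_def degree_add_le_max)
  thus ?thesis
    by (simp add: euler_functional_altdef algebra_simps sum.distrib)
qed

lemma euler_functional_smult: "euler_functional (smult c p) = c * euler_functional p"
proof -
  have "degree (smult c p) \<le> degree p"
    by (rule degree_smult_le)
  thus ?thesis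
    by (simp add: euler_functional_altdef[of _ "degree p"] sum_distrib_left mult.assoc)
qed

lemma euler_functional_0 [simp]: "euler_functional 0 = 0"
  by (simp add: euler_functional_def)

lemma euler_functional_sum:
  "euler_functional (\<Sum>i\<in>I. f i) = (\<Sum>i\<in>I. euler_functional (f i))"
  by (induction I rule: infinite_finite_induct) (auto simp: euler_functional_add)

text \<open>Compare \<open>m!\<close> times the coefficients of t^m in (e^t + 1) E(t) = 2:
  multiplication by e^t becomes binomial convolution.\<close>

lemma euler_number_recurrence:
  "(\<Sum>k\<le>m. real (m choose k) * euler_number k) + euler_number m = (if m = 0 then 2 else 0)"
proof -
  let ?E = "2 / (fps_exp 1 + 1) :: real fps"
  have "?E * (fps_exp 1 + 1) = 2"
    by (simp add: fps_divide_unit mult.assoc inverse_mult_eq_1)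
  hence "fact m * fps_nth (?E * fps_exp 1 + ?E) m = fact m * fps_nth 2 m"
    by (simp add: algebra_simps)
  moreover have "fact m * fps_nth (?E * fps_exp 1) m = (\<Sum>k\<le>m. real (m choose k) * euler_number k)"
    unfolding fps_mult_nth sum_distrib_left atMost_atLeast0
    by (intro sum.cong) (auto simp: euler_number_def binomial_fact)
  moreover have "fact m * fps_nth (2 :: real fps) m = (if m = 0 then 2 else 0)"
    by (simp add: numeral_fps_const)
  ultimately show ?thesis
    by (simp add: distrib_left euler_number_def)
qed

lemma euler_functional_shift_monom:
  "euler_functional (monom 1 m \<circ>\<^sub>p [:1, 1:]) + euler_functional (monom 1 m) = 2 * poly (monom 1 m) 0"
proof -
  have eq: "monom 1 m \<circ>\<^sub>p [:1, 1:] = ([:1, 1:] ^ m :: real poly)"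
    by (rule poly_ext) (simp add: poly_pcompose poly_monom)
  have "degree ([:1, 1:] ^ m :: real poly) \<le> m"
    by (simp add: degree_linear_power)
  hence "euler_functional (monom 1 m \<circ>\<^sub>p [:1, 1:]) = (\<Sum>k\<le>m. real (m choose k) * euler_number k)"
    unfolding eq by (simp add: euler_functional_altdef coeff_linear_poly_power)
  moreover have "euler_functional (monom 1 m) = euler_number m"
    by (simp add: euler_functional_def degree_monom_eq if_distrib[of "\<lambda>c. c * _"] cong: if_cong)
  ultimately show ?thesis
    using euler_number_recurrence[of m] by (simp add: poly_monom power_0_left)
qed

text \<open>Both sides are linear in \<open>p\<close>, so the case of monomials suffices; there,
  expanding (x + 1)^m gives the recurrence.\<close>

lemma euler_functional_shift:
  "euler_functional (p \<circ>\<^sub>p [:1, 1:]) + euler_functional p = 2 * poly p 0"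
proof -
  let ?m = "\<lambda>i. monom 1 i :: real poly"
  have p: "p = (\<Sum>i\<le>degree p. smult (coeff p i) (?m i))"
    using poly_as_sum_of_monoms[of p] by (simp add: smult_monom)
  have "euler_functional (p \<circ>\<^sub>p [:1, 1:]) + euler_functional p =
      (\<Sum>i\<le>degree p. coeff p i * (euler_functional (?m i \<circ>\<^sub>p [:1, 1:]) + euler_functional (?m i)))"
    \<comment> \<open>Only the two occurrences on the left are expanded; those in
      \<open>coeff p i\<close> and \<open>degree p\<close> must stay.\<close>
    by (subst (1 2) p)
       (simp only: pcompose_sum pcompose_smult euler_functional_sum euler_functional_smult
         distrib_left sum.distrib)
  also have "\<dots> = 2 * poly (\<Sum>i\<le>degree p. smult (coeff p i) (?m i)) 0"
    by (simp only: euler_functional_shift_monom poly_sum poly_smult sum_distrib_left mult.left_commute)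
  finally show ?thesis
    using p by simp
qed

definition half_binomial_poly :: "nat \<Rightarrow> real poly" where
  "half_binomial_poly n = smult (1 / fact n) (\<Prod>i<n. [:- real i, 1 / 2:])"

lemma poly_half_binomial_poly: "poly (half_binomial_poly n) x = (x / 2) gchoose n"
  by (simp add: half_binomial_poly_def gbinomial_prod_rev poly_prod atLeast0LessThan algebra_simps)

text \<open>Replacing x by x/2 in the falling factorial scales the coefficient of x^m by
  2^(-m).\<close>

lemma coeff_half_binomial_poly:
  "coeff (half_binomial_poly n) m = (1 / 2) ^ m * real_of_int (S1 n m) / fact n"
proof -
  have "coeff (\<Prod>i<n. [:- real i, 1 / 2:]) m = (1 / 2) ^ m * real_of_int (S1 n m)"
    unfolding S1_def
    by (induction n arbitrary: m) (auto simp: coeff_pCons algebra_simps intro!: gr0I split: nat.splits)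
  thus ?thesis
    by (simp add: half_binomial_poly_def)
qed

lemma degree_half_binomial_poly: "degree (half_binomial_poly n) \<le> n"
proof -
  have "degree (\<Prod>i<n. [:- real i, 1 / 2:]) \<le> (\<Sum>i<n. degree [:- real i, 1 / 2:])"
    using degree_prod_sum_le[of "{..<n}" "\<lambda>i. [:- real i, 1 / 2:]"] by (simp add: o_def)
  thus ?thesis
    by (simp add: half_binomial_poly_def)
qed

text \<open>Since (x + 1)/2 = x/2 + 1/2, this is Vandermonde at each real x, and real polynomials
  that agree everywhere are equal.\<close>

lemma half_binomial_poly_shift:
  "half_binomial_poly n \<circ>\<^sub>p [:1, 1:] =
     (\<Sum>k=0..n. smult ((1 / 2) gchoose (n - k)) (half_binomial_poly k))"
proof (rule poly_ext)
  fix x :: real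
  show "poly (half_binomial_poly n \<circ>\<^sub>p [:1, 1:]) x =
      poly (\<Sum>k=0..n. smult ((1 / 2) gchoose (n - k)) (half_binomial_poly k)) x"
    using gbinomial_Vandermonde[of "x / 2" "1 / 2" n]
    by (simp add: poly_pcompose poly_half_binomial_poly poly_sum atMost_atLeast0 add_divide_distrib
        algebra_simps)
qed

lemma euler_functional_half_binomial_poly:
  "euler_functional (half_binomial_poly n) = 2 * ((1 / 2) gchoose Suc n)"
proof -
  define A where "A = Abs_fps (\<lambda>n. euler_functional (half_binomial_poly n))"
  define B where "B = fps_binomial (1 / 2 :: real)"
  have "A * B + A = 2"
  proof (rule fps_ext)
    fix n
    have "fps_nth (A * B + A) n = 2 * poly (half_binomial_poly n) 0"
      \<comment> \<open>The shifted term is a convolution with the coefficients of \<open>B\<close>,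
        hence the product \<open>A * B\<close>.\<close>
      unfolding euler_functional_shift[symmetric] half_binomial_poly_shift
      by (simp add: A_def B_def fps_mult_nth euler_functional_sum euler_functional_smult
          mult.commute)
    thus "fps_nth (A * B + A) n = fps_nth 2 n"
      \<comment> \<open>The value at 0 is \<open>0 gchoose n\<close>, which is 1 for
        \<open>n = 0\<close> and 0 otherwise.\<close>
      by (cases n) (simp_all add: poly_half_binomial_poly numeral_fps_const)
  qed
  moreover have "B * B = 1 + fps_X"
    by (simp add: B_def fps_binomial_add_mult[symmetric] fps_binomial_1)
  moreover have "A * (B * B - 1) = (A * B + A) * (B - 1)"
    by (simp add: algebra_simps)
  ultimately have "A * fps_X = 2 * (B - 1)"
    by simp
  \<comment> \<open>The factor \<open>fps_X\<close> shifts the index by one, and at a positive index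
    the constant in \<open>B - 1\<close> drops out.\<close>
  hence "fps_nth (A * fps_X) (Suc n) = fps_nth (2 * (B - 1)) (Suc n)"
    by simp
  thus ?thesis
    by (simp add: A_def B_def numeral_fps_const)
qed

text \<open>Both sides equal 1 at 0 and satisfy (n + 2) u(n+1) = 2 (2n + 1) u(n).\<close>

lemma catalan_gbinomial: "catalan n = (-4) ^ n * (2 * ((1 / 2) gchoose Suc n))"
proof (induction n)
  case 0
  show ?case
    by (simp add: catalan_def)
next
  case (Suc n)
  have rec: "real (n + 2) * catalan (Suc n) = 2 * real (2 * n + 1) * catalan n"
  proof -
    have binom: "real ((2 * k) choose k) = fact (2 * k) / (fact k * fact k)" for k
      by (simp add: binomial_fact)
    show ?thesis
      unfolding catalan_def binom by (simp add: divide_simps) (simp add: algebra_simps)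
  qed
  \<comment> \<open>By the two absorption identities, both sides equal 1/2 times (-1/2 choose n +
    1).\<close>
  have step: "real (n + 2) * ((1 / 2) gchoose Suc (Suc n)) = (1 / 2 - real (Suc n)) * ((1 / 2) gchoose Suc n)"
    using gbinomial_absorb_comp[of "1 / 2 :: real" "Suc n"] gbinomial_absorption[of "Suc n" "1 / 2 :: real"]
    by simp
  have "real (n + 2) * ((-4) ^ Suc n * (2 * ((1 / 2) gchoose Suc (Suc n)))) =
      (-4) ^ n * (-8) * (real (n + 2) * ((1 / 2) gchoose Suc (Suc n)))"
    by (simp only: power_Suc mult_ac)
  also have "\<dots> = 2 * real (2 * n + 1) * ((-4) ^ n * (2 * ((1 / 2) gchoose Suc n)))"
    unfolding step by (simp add: algebra_simps)
  finally have "real (n + 2) * ((-4) ^ Suc n * (2 * ((1 / 2) gchoose Suc (Suc n)))) =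
      2 * real (2 * n + 1) * ((-4) ^ n * (2 * ((1 / 2) gchoose Suc n)))" .
  with rec have "real (n + 2) * catalan (Suc n) =
      real (n + 2) * ((-4) ^ Suc n * (2 * ((1 / 2) gchoose Suc (Suc n))))"
    by (simp only: Suc.IH)
  thus ?case
    by (simp only: mult_cancel_left) simp
qed

theorem theorem4:
  fixes n :: nat
  shows "catalan n =
    (-1) ^ n / fact n *
      (\<Sum>m=0..n. 2 ^ (2 * n - m) * euler_number m * real_of_int (S1 n m))"
proof -
  have "catalan n = (-4) ^ n * euler_functional (half_binomial_poly n)"
    by (simp add: catalan_gbinomial euler_functional_half_binomial_poly)
  also have "\<dots> = (\<Sum>m=0..n. (-1) ^ n / fact n *
      (4 ^ n * (1 / 2) ^ m * euler_number m * real_of_int (S1 n m)))"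
    by (simp add: euler_functional_altdef[OF degree_half_binomial_poly] coeff_half_binomial_poly
        atMost_atLeast0 sum_distrib_left power_minus[of 4] mult_ac)
  also have "\<dots> = (\<Sum>m=0..n. (-1) ^ n / fact n *
      (2 ^ (2 * n - m) * euler_number m * real_of_int (S1 n m)))"
  proof (intro sum.cong refl)
    fix m assume "m \<in> {0..n}"
    \<comment> \<open>The bound m \<le> n keeps the natural subtraction \<open>2 * n - m\<close>
      from truncating.\<close>
    hence "(4::real) ^ n * (1 / 2) ^ m = 2 ^ (2 * n - m)"
      by (simp add: power_diff power_mult power_divide)
    thus "(-1) ^ n / fact n * (4 ^ n * (1 / 2) ^ m * euler_number m * real_of_int (S1 n m)) =
        (-1) ^ n / fact n * (2 ^ (2 * n - m) * euler_number m * real_of_int (S1 n m))"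
      by (simp only:)
  qed
  finally show ?thesis
    by (simp only: sum_distrib_left)
qed

end
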